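(* For any pair $m$ and $k$ of positive integers, there exists a constant $C=C(m,k)$ such that ${\rm sat}^*(n,mC_k)\le C\cdot n$ for all positive integers $n$.
   Context: For a poset $P=(P,\leqslant)$, a family $\mathcal{G}$ of sets is a (induced) copy of $P$ if there is a bijection $b:P\to\mathcal{G}$ such that $p\leqslant q$ if and only if $b(p)\subseteq b(q)$. A family $\mathcal{F}\subseteq 2^{[n]}$ (where $[n]=\{1,\dots,n\}$) is induced $P$-saturated if $\mathcal{F}$ contains no copy of $P$, but for every $G\in 2^{[n]}\setminus\mathcal{F}$ the family $\mathcal{F}\cup\{G\}$ contains a copy of $P$. The induced saturation number ${\rm sat}^*(n,P)$ is the minimum size of an induced $P$-saturated family $\mathcal{F}\subseteq 2^{[n]}$. $C_k$ denotes the chain (totally ordered poset) with $k$ elements. For posets $P,P'$, $P+P'$ is the disjoint union of $P$ and $P'$ with no element of $P$ comparable to any element of $P'$, and $mP$ denotes the disjoint union of $m$ pairwise incomparable copies of $P$. *)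

theory Defs
  imports Complex_Main
begin

text \<open>A poset is represented by its reflexive order relation \<open>P\<close>, as in
  \<^theory>\<open>HOL.Order_Relation\<close>; its ground set is \<open>Field P\<close>.\<close>

definition is_copy :: "'a rel \<Rightarrow> 'b set set \<Rightarrow> bool" where
  "is_copy P \<G> \<longleftrightarrow> (\<exists>b. bij_betw b (Field P) \<G> \<and>
     (\<forall>p\<in>Field P. \<forall>q\<in>Field P. (p, q) \<in> P \<longleftrightarrow> b p \<subseteq> b q))"

definition contains_copy :: "'a rel \<Rightarrow> 'b set set \<Rightarrow> bool" where
  "contains_copy P \<F> \<longleftrightarrow> (\<exists>\<G>\<subseteq>\<F>. is_copy P \<G>)"

definition induced_saturated :: "nat \<Rightarrow> 'a rel \<Rightarrow> nat set set \<Rightarrow> bool" where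
  "induced_saturated n P \<F> \<longleftrightarrow> \<F> \<subseteq> Pow {1..n} \<and> \<not> contains_copy P \<F> \<and>
     (\<forall>G\<in>Pow {1..n} - \<F>. contains_copy P (\<F> \<union> {G}))"

text \<open>The minimum is over a nonempty finite set whenever \<open>P\<close> is nonempty; see
  \<open>sat_star_attained\<close> below.\<close>

definition sat_star :: "nat \<Rightarrow> 'a rel \<Rightarrow> nat" where
  "sat_star n P = Min (card ` {\<F>. induced_saturated n P \<F>})"

definition chain_poset :: "nat \<Rightarrow> nat rel" where
  "chain_poset k = {(i, j). i \<le> j \<and> j < k}"

definition copies :: "nat \<Rightarrow> 'a rel \<Rightarrow> (nat \<times> 'a) rel" where
  "copies m P = {((i, x), (j, y)). i = j \<and> i < m \<and> (x, y) \<in> P}"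

lemma Field_chain_poset: "Field (chain_poset k) = {..<k}"
proof (intro equalityI subsetI)
  fix i assume "i \<in> {..<k}"
  then have "(i, i) \<in> chain_poset k"
    by (simp add: chain_poset_def)
  then show "i \<in> Field (chain_poset k)"
    by (rule FieldI1)
qed (auto simp: chain_poset_def Field_def)

lemma linear_order_on_chain_poset: "linear_order_on {..<k} (chain_poset k)"
  by (auto simp: chain_poset_def linear_order_on_def partial_order_on_def preorder_on_def
      refl_on_def trans_def antisym_def total_on_def)

lemma Field_copies: "Field (copies m P) = {..<m} \<times> Field P"
  by (auto simp: copies_def Field_def)

lemma partial_order_on_copies:
  assumes "partial_order_on A P"
  shows "partial_order_on ({..<m} \<times> A) (copies m P)"
proof -
  have r: "refl_on A P" and P: "P \<subseteq> A \<times> A" and t: "trans P" and a: "antisym P"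
    using assms by (simp_all add: partial_order_on_def preorder_on_def)
  have "refl_on ({..<m} \<times> A) (copies m P)"
    using r by (simp add: copies_def refl_on_def)
  moreover have "copies m P \<subseteq> ({..<m} \<times> A) \<times> ({..<m} \<times> A)"
    using P by (auto simp: copies_def)
  moreover have "trans (copies m P)"
    using t unfolding copies_def trans_def by blast
  moreover have "antisym (copies m P)"
    using a unfolding copies_def antisym_def by blast
  ultimately show ?thesis
    by (simp add: partial_order_on_def preorder_on_def)
qed

lemma finite_induced_saturated: "finite {\<F>. induced_saturated n P \<F>}"
  by (rule finite_subset[of _ "Pow (Pow {1..n})"]) (auto simp: induced_saturated_def)

lemma induced_saturated_exists:
  assumes "Field P \<noteq> {}"
  shows "\<exists>\<F>. induced_saturated n P \<F>"
proof -
  let ?S = "{\<F>. \<F> \<subseteq> Pow {1..n} \<and> \<not> contains_copy P \<F>}"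
  have "finite ?S"
    by (rule finite_subset[of _ "Pow (Pow {1..n})"]) auto
  moreover have "{} \<in> ?S"
    using assms by (auto simp: contains_copy_def is_copy_def bij_betw_def)
  ultimately obtain \<F> where F: "\<F> \<in> ?S" and mx: "\<And>\<H>. \<H> \<in> ?S \<Longrightarrow> \<F> \<subseteq> \<H> \<Longrightarrow> \<F> = \<H>"
    using finite_has_maximal[of ?S] by (metis (no_types, lifting) empty_iff)
  have "contains_copy P (\<F> \<union> {G})" if "G \<in> Pow {1..n} - \<F>" for G
  proof (rule ccontr)
    assume "\<not> contains_copy P (\<F> \<union> {G})"
    then have "\<F> \<union> {G} \<in> ?S"
      using F that by simp
    then have "\<F> = \<F> \<union> {G}"
      by (rule mx) blast
    with that show False
      by blast
  qed
  with F show ?thesis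
    by (auto simp: induced_saturated_def)
qed

lemma sat_star_attained:
  assumes "Field P \<noteq> {}"
  shows "\<exists>\<F>. induced_saturated n P \<F> \<and> card \<F> = sat_star n P"
proof -
  have "sat_star n P \<in> card ` {\<F>. induced_saturated n P \<F>}"
    unfolding sat_star_def
    by (rule Min_in) (use finite_induced_saturated induced_saturated_exists[OF assms] in auto)
  then show ?thesis
    by auto
qed

lemma sat_star_le: "induced_saturated n P \<F> \<Longrightarrow> sat_star n P \<le> card \<F>"
  unfolding sat_star_def by (rule Min_le) (auto simp: finite_induced_saturated)

end

theory Submission
  imports Defs "HOL-Library.FuncSet"
begin

text \<open>
  It suffices to find a family \<open>B\<close> without \<open>m\<close> incomparable \<open>k\<close>-chains such that all but
  \<open>O(n)\<close> sets \<open>G\<close> complete such a configuration together with \<open>B\<close>: a maximal extension of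
  \<open>B\<close> is then saturated and consists of exceptional sets only.

  Cut the ground set into blocks \<open>N\<close> of constant size, each with a marked subset \<open>S\<close>, and let
  \<open>i\<close> be the first block in which the trace of \<open>G\<close> differs from \<open>S\<close>. A gadget on block \<open>i\<close> has
  height \<open>k - 1\<close>, but every \<open>G\<close> deviating there extends it to a \<open>k\<close>-chain. In addition \<open>B\<close>
  contains \<open>m - 1\<close> mutually incomparable long chains (rails), whose members have trace \<open>S\<close> on
  the first \<open>u\<close> blocks and are empty or full afterwards; unless \<open>G\<close> is itself empty or full from
  block \<open>i + k\<close> on, each of them has \<open>k\<close> consecutive members incomparable to everything used
  around \<open>G\<close>.

  In the gadget, \<open>S\<close> consists of \<open>k\<close> letters, and \<open>N - S\<close> of all orderings of \<open>S\<close>. A trace \<open>T\<close>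
  is ranked by the longest prefix of an ordering in \<open>T\<close> whose letters all belong to \<open>T\<close>. This rank
  is monotone, minimal strictly below \<open>S\<close>, maximal strictly above \<open>S\<close>, and takes every
  intermediate value on the way.
\<close>

section \<open>Disjoint chains in ordered types\<close>

text \<open>Stated for an arbitrary order, since it is applied both to sets under inclusion and to
  functions listing block traces under the pointwise order. The equivalence makes \<open>D\<close>
  injective on its index range by antisymmetry.\<close>

definition has_chains :: "nat \<Rightarrow> nat \<Rightarrow> 'a::order set \<Rightarrow> bool" where
  "has_chains m k F \<longleftrightarrow> (\<exists>D. (\<forall>i<m. \<forall>j<k. D i j \<in> F) \<and>
     (\<forall>i<m. \<forall>j<k. \<forall>i'<m. \<forall>j'<k. D i j \<le> D i' j' \<longleftrightarrow> i = i' \<and> j \<le> j'))"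

lemma has_chains_mono: "has_chains m k F \<Longrightarrow> F \<subseteq> F' \<Longrightarrow> has_chains m k F'"
  unfolding has_chains_def
proof (elim exE conjE)
  fix D assume "F \<subseteq> F'" "\<forall>i<m. \<forall>j<k. D i j \<in> F"
    "\<forall>i<m. \<forall>j<k. \<forall>i'<m. \<forall>j'<k. D i j \<le> D i' j' \<longleftrightarrow> i = i' \<and> j \<le> j'"
  then show "\<exists>D. (\<forall>i<m. \<forall>j<k. D i j \<in> F') \<and>
     (\<forall>i<m. \<forall>j<k. \<forall>i'<m. \<forall>j'<k. D i j \<le> D i' j' \<longleftrightarrow> i = i' \<and> j \<le> j')"
    by (intro exI[of _ D]) blast
qed

lemma contains_copy_iff_has_chains:
  "contains_copy (copies m (chain_poset k)) \<F> \<longleftrightarrow> has_chains m k \<F>"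
proof
  have fld: "Field (copies m (chain_poset k)) = {..<m} \<times> {..<k}"
    by (simp add: Field_copies Field_chain_poset)
  {
    assume "contains_copy (copies m (chain_poset k)) \<F>"
    then obtain \<G> b where "\<G> \<subseteq> \<F>" and bij: "bij_betw b ({..<m} \<times> {..<k}) \<G>"
      and ord: "\<forall>p\<in>{..<m} \<times> {..<k}. \<forall>q\<in>{..<m} \<times> {..<k}.
        (p, q) \<in> copies m (chain_poset k) \<longleftrightarrow> b p \<subseteq> b q"
      unfolding contains_copy_def is_copy_def fld by blast
    have "b (i, j) \<in> \<F>" if "i < m" "j < k" for i j
      using bij_betwE[OF bij] \<open>\<G> \<subseteq> \<F>\<close> that by auto
    moreover have "b (i, j) \<subseteq> b (i', j') \<longleftrightarrow> i = i' \<and> j \<le> j'"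
      if "i < m" "j < k" "i' < m" "j' < k" for i j i' j'
      using ord[rule_format, of "(i, j)" "(i', j')"] that
      by (simp add: copies_def chain_poset_def)
    ultimately show "has_chains m k \<F>"
      unfolding has_chains_def by (intro exI[of _ "\<lambda>i j. b (i, j)"]) simp
  next
    assume "has_chains m k \<F>"
    then obtain D where D: "\<forall>i<m. \<forall>j<k. D i j \<in> \<F>"
      and ord: "\<forall>i<m. \<forall>j<k. \<forall>i'<m. \<forall>j'<k. D i j \<subseteq> D i' j' \<longleftrightarrow> i = i' \<and> j \<le> j'"
      unfolding has_chains_def by (elim exE conjE)
    let ?b = "\<lambda>(i, j). D i j"
    have "inj_on ?b ({..<m} \<times> {..<k})"
    proof (rule inj_onI, clarsimp)
      fix i j i' j' assume "i < m" "j < k" "i' < m" "j' < k" "D i j = D i' j'"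
      then show "i = i' \<and> j = j'"
        using ord by (metis order_antisym order_refl)
    qed
    then have "bij_betw ?b ({..<m} \<times> {..<k}) (?b ` ({..<m} \<times> {..<k}))"
      by (simp add: bij_betw_def)
    moreover have "\<forall>p\<in>{..<m} \<times> {..<k}. \<forall>q\<in>{..<m} \<times> {..<k}.
        (p, q) \<in> copies m (chain_poset k) \<longleftrightarrow> ?b p \<subseteq> ?b q"
      using ord by (auto simp: copies_def chain_poset_def)
    ultimately have "is_copy (copies m (chain_poset k)) (?b ` ({..<m} \<times> {..<k}))"
      unfolding is_copy_def fld by blast
    moreover have "?b ` ({..<m} \<times> {..<k}) \<subseteq> \<F>"
      using D by auto
    ultimately show "contains_copy (copies m (chain_poset k)) \<F>"
      unfolding contains_copy_def by blast
  }
qed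

section \<open>Saturated families from a base family\<close>

text \<open>A maximal extension of \<open>B\<close> without the forbidden configuration is
  saturated. Each of its members \<open>G\<close> leaves \<open>insert G B\<close> free of the
  configuration as well, so it lies in \<open>K\<close>.\<close>

lemma sat_star_le_card_candidates:
  assumes "B \<subseteq> Pow {1..n}" "\<not> has_chains m k B"
    and "\<And>G. G \<in> Pow {1..n} \<Longrightarrow> G \<notin> K \<Longrightarrow> has_chains m k (insert G B)"
    and "finite K"
  shows "sat_star n (copies m (chain_poset k)) \<le> card K"
proof -
  define \<S> where "\<S> = {\<F>. \<F> \<subseteq> Pow {1..n} \<and> \<not> has_chains m k \<F>}"
  have "finite \<S>"
    unfolding \<S>_def by (rule finite_subset[of _ "Pow (Pow {1..n})"]) auto
  moreover have "B \<in> \<S>"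
    using assms by (simp add: \<S>_def)
  ultimately have "\<exists>\<F>\<in>\<S>. B \<subseteq> \<F> \<and> (\<forall>\<H>\<in>\<S>. \<F> \<subseteq> \<H> \<longrightarrow> \<F> = \<H>)"
    by (rule finite_has_maximal2)
  then obtain \<F> where "\<F> \<in> \<S>" "B \<subseteq> \<F>" and mx: "\<forall>\<H>\<in>\<S>. \<F> \<subseteq> \<H> \<longrightarrow> \<F> = \<H>"
    by (elim bexE conjE)
  then have F: "\<F> \<subseteq> Pow {1..n}" "\<not> has_chains m k \<F>" "B \<subseteq> \<F>"
    by (simp_all add: \<S>_def)
  have "has_chains m k (\<F> \<union> {G})" if "G \<in> Pow {1..n} - \<F>" for G
  proof (rule ccontr)
    assume "\<not> has_chains m k (\<F> \<union> {G})"
    then have "\<F> \<union> {G} \<in> \<S>"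
      using F that by (simp add: \<S>_def)
    then have "\<F> = \<F> \<union> {G}"
      using mx by blast
    with that show False
      by blast
  qed
  then have "induced_saturated n (copies m (chain_poset k)) \<F>"
    using F by (auto simp: induced_saturated_def contains_copy_iff_has_chains)
  then have "sat_star n (copies m (chain_poset k)) \<le> card \<F>"
    by (rule sat_star_le)
  also have "\<F> \<subseteq> K"
  proof
    fix G assume "G \<in> \<F>"
    moreover have "\<not> has_chains m k (insert G B)"
      using F \<open>G \<in> \<F>\<close> has_chains_mono[of m k "insert G B" \<F>] by blast
    ultimately show "G \<in> K"
      using assms(3) F by blast
  qed
  then have "card \<F> \<le> card K"
    by (rule card_mono[OF \<open>finite K\<close>])
  finally show ?thesis .
qed

text \<open>This crude bound serves the finitely many \<open>n < m\<close>, where the ground set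
  cannot hold a final block of at least \<open>m\<close> points.\<close>

lemma sat_star_le_power:
  assumes "m \<ge> 1" "k \<ge> 1"
  shows "sat_star n (copies m (chain_poset k)) \<le> 2 ^ n"
proof -
  have "\<not> has_chains m k {}"
    using assms by (auto simp: has_chains_def intro!: exI[of _ 0])
  then have "sat_star n (copies m (chain_poset k)) \<le> card (Pow {1..n})"
    by (intro sat_star_le_card_candidates[of "{}"]) auto
  then show ?thesis
    by (simp add: card_Pow)
qed

lemma has_chains_image_iff:
  assumes "\<And>x y. x \<in> F \<Longrightarrow> y \<in> F \<Longrightarrow> \<phi> x \<le> \<phi> y \<longleftrightarrow> x \<le> y"
  shows "has_chains m k (\<phi> ` F) \<longleftrightarrow> has_chains m k F"
proof
  assume "has_chains m k (\<phi> ` F)"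
  then obtain D where D: "\<forall>i<m. \<forall>j<k. D i j \<in> \<phi> ` F"
    and ord: "\<forall>i<m. \<forall>j<k. \<forall>i'<m. \<forall>j'<k. D i j \<le> D i' j' \<longleftrightarrow> i = i' \<and> j \<le> j'"
    unfolding has_chains_def by (elim exE conjE)
  define E where "E i j = inv_into F \<phi> (D i j)" for i j
  have E: "E i j \<in> F" "\<phi> (E i j) = D i j" if "i < m" "j < k" for i j
    using D that by (simp_all add: E_def inv_into_into f_inv_into_f)
  show "has_chains m k F"
    unfolding has_chains_def
  proof (intro exI[of _ E] conjI allI impI)
    fix i j i' j' assume "i < m" "j < k" "i' < m" "j' < k"
    then show "E i j \<le> E i' j' \<longleftrightarrow> i = i' \<and> j \<le> j'"
      using E[of i j] E[of i' j'] ord assms[of "E i j" "E i' j'"] by simp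
  qed (use E in simp)
next
  assume "has_chains m k F"
  then obtain D where D: "\<forall>i<m. \<forall>j<k. D i j \<in> F"
    and ord: "\<forall>i<m. \<forall>j<k. \<forall>i'<m. \<forall>j'<k. D i j \<le> D i' j' \<longleftrightarrow> i = i' \<and> j \<le> j'"
    unfolding has_chains_def by (elim exE conjE)
  show "has_chains m k (\<phi> ` F)"
    unfolding has_chains_def
    by (intro exI[of _ "\<lambda>i j. \<phi> (D i j)"]) (use D ord assms in auto)
qed

section \<open>A gadget of height less than k\<close>

text \<open>The sets in \<open>A0\<close> lie below, and those in \<open>A1\<close> lie above, the full interval of sets
  with a given trace on \<open>N\<close>. The labels bound the height of this two-layer family by \<open>k - 1\<close>.\<close>

locale chain_gadget =
  fixes k :: nat and N S :: "'g set" and A0 A1 :: "'g set set"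
    and lab0 lab1 :: "'g set \<Rightarrow> nat"
  assumes finite_N: "finite N" and S_subset: "S \<subset> N" and S_nonempty: "S \<noteq> {}"
    and A0: "X \<in> A0 \<Longrightarrow> X \<subseteq> N \<and> \<not> X \<subseteq> S"
    and A1: "Y \<in> A1 \<Longrightarrow> Y \<subseteq> N \<and> \<not> S \<subseteq> Y"
    and lab0_less: "X \<in> A0 \<Longrightarrow> lab0 X < k - 1"
    and lab1_less: "Y \<in> A1 \<Longrightarrow> lab1 Y < k - 1"
    and lab00: "X \<in> A0 \<Longrightarrow> X' \<in> A0 \<Longrightarrow> X \<subset> X' \<Longrightarrow> lab0 X < lab0 X'"
    and lab01: "X \<in> A0 \<Longrightarrow> Y \<in> A1 \<Longrightarrow> X \<subseteq> Y \<Longrightarrow> lab0 X < lab1 Y"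
    and lab11: "Y \<in> A1 \<Longrightarrow> Y' \<in> A1 \<Longrightarrow> Y \<subset> Y' \<Longrightarrow> lab1 Y < lab1 Y'"
    and saturated: "T \<subseteq> N \<Longrightarrow> T \<noteq> S \<Longrightarrow> \<exists>v X Y. v < k \<and>
      (\<forall>j<v. X j \<in> A0 \<and> X j \<subseteq> T) \<and> (\<forall>j. v \<le> j \<and> j < k - 1 \<longrightarrow> Y j \<in> A1 \<and> T \<subseteq> Y j) \<and>
      (\<forall>j j'. j < j' \<and> j' < v \<longrightarrow> X j \<subset> X j') \<and>
      (\<forall>j j'. v \<le> j \<and> j < j' \<and> j' < k - 1 \<longrightarrow> Y j \<subset> Y j')"

section \<open>Ranking traces by prefixes of orderings\<close>

definition prefix_in :: "nat \<Rightarrow> (nat + nat list) set \<Rightarrow> bool" where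
  "prefix_in j T \<longleftrightarrow> (\<exists>q. Inr q \<in> T \<and> Inl ` set (take j q) \<subseteq> T)"

text \<open>As \<open>prefix_in j T\<close> is antitone in \<open>j\<close>, this counts the
  \<open>j < k - 1\<close> for which it holds. The value is 0 if \<open>T\<close> contains no
  ordering, and otherwise one more than the longest available prefix length, capped at
  \<open>k - 1\<close>.\<close>

definition level :: "nat \<Rightarrow> (nat + nat list) set \<Rightarrow> nat" where
  "level k T = (LEAST j. j \<ge> k - 1 \<or> \<not> prefix_in j T)"

lemma prefix_in_antimono: "prefix_in j T \<Longrightarrow> i \<le> j \<Longrightarrow> prefix_in i T"
  unfolding prefix_in_def by (meson image_mono order_trans set_take_subset_set_take)

lemma prefix_in_mono: "prefix_in j T \<Longrightarrow> T \<subseteq> T' \<Longrightarrow> prefix_in j T'"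
  unfolding prefix_in_def by blast

lemma level_le: "level k T \<le> k - 1"
  unfolding level_def by (rule Least_le) simp

lemma less_level_iff:
  assumes "j < k - 1"
  shows "j < level k T \<longleftrightarrow> prefix_in j T"
proof
  assume "j < level k T"
  then show "prefix_in j T"
    unfolding level_def using not_less_Least by blast
next
  assume *: "prefix_in j T"
  have "level k T \<ge> k - 1 \<or> \<not> prefix_in (level k T) T"
    unfolding level_def by (rule LeastI[of _ "k - 1"]) simp
  then show "j < level k T"
    using * assms prefix_in_antimono[of j T "level k T"] by linarith
qed

lemma level_mono: "T \<subseteq> T' \<Longrightarrow> level k T \<le> level k T'"
proof (rule ccontr)
  assume "T \<subseteq> T'" "\<not> level k T \<le> level k T'"
  then have "level k T' < k - 1" "level k T' < level k T"
    using level_le[of k T] by linarith+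
  then show False
    using less_level_iff \<open>T \<subseteq> T'\<close> prefix_in_mono by blast
qed

definition letters :: "nat \<Rightarrow> (nat + nat list) set" where
  "letters k = Inl ` {..<k}"

definition orderings :: "nat \<Rightarrow> nat list set" where
  "orderings k = {q. distinct q \<and> set q = {..<k}}"

definition ground :: "nat \<Rightarrow> (nat + nat list) set" where
  "ground k = letters k \<union> Inr ` orderings k"

lemma length_orderings: "q \<in> orderings k \<Longrightarrow> length q = k"
  unfolding orderings_def using distinct_card by fastforce

lemma finite_ground: "finite (ground k)"
proof -
  have "orderings k \<subseteq> {q. set q \<subseteq> {..<k} \<and> length q = k}"
    using length_orderings by (auto simp: orderings_def)
  then have "finite (orderings k)"
    using finite_lists_length_eq[of "{..<k}" k] finite_subset by blast
  then show ?thesis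
    by (simp add: ground_def letters_def)
qed

text \<open>List \<open>v\<close> elements of \<open>U\<close> first, then a letter outside
  \<open>U\<close>, then all remaining letters.\<close>

lemma ordering_with_prefix:
  assumes "U \<subset> {..<k}" "v \<le> card U"
  shows "\<exists>q\<in>orderings k. set (take v q) \<subseteq> U \<and> \<not> set (take (Suc v) q) \<subseteq> U"
proof -
  obtain W where W: "W \<subseteq> U" "card W = v"
    using assms(2) obtain_subset_with_card_n by metis
  obtain s where s: "s \<in> {..<k}" "s \<notin> U"
    using assms(1) by blast
  have fin: "finite W"
    using W assms(1) finite_subset[of W "{..<k}"] by auto
  define w where "w = sorted_list_of_set W"
  define q where "q = w @ s # sorted_list_of_set ({..<k} - insert s W)"
  have w: "set w = W" "distinct w" "length w = v"
    using fin W by (simp_all add: w_def)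
  have "q \<in> orderings k"
    unfolding orderings_def q_def using w s W assms(1) by auto
  moreover have "take v q = w" "take (Suc v) q = w @ [s]"
    using w by (simp_all add: q_def)
  ultimately show ?thesis
    using w W s by (intro bexI[of _ q]) auto
qed

text \<open>A proper superset of all letters contains an ordering, every prefix of which is then
  available.\<close>

lemma level_above_letters:
  assumes "letters k \<subset> T" "T \<subseteq> ground k"
  shows "level k T = k - 1"
proof (rule ccontr)
  assume "level k T \<noteq> k - 1"
  then have lt: "level k T < k - 1"
    using level_le[of k T] by linarith
  obtain q where q: "Inr q \<in> T" "q \<in> orderings k"
    using assms by (auto simp: ground_def)
  then have "Inl ` set (take (level k T) q) \<subseteq> T"
    using assms(1) set_take_subset[of _ q] by (fastforce simp: orderings_def letters_def)
  then have "prefix_in (level k T) T"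
    using q unfolding prefix_in_def by blast
  then show False
    using less_level_iff[OF lt, of T] by simp
qed

lemma level_eqI:
  assumes "v < k - 1" "v > 0 \<Longrightarrow> prefix_in (v - 1) T" "\<not> prefix_in v T"
  shows "level k T = v"
proof -
  have "\<not> v < level k T"
    using assms less_level_iff by blast
  moreover have "v \<le> level k T"
    using assms less_level_iff[of "v - 1" k T] by (cases "v = 0") fastforce+
  ultimately show ?thesis
    by simp
qed

text \<open>The ordering added has its first \<open>v\<close> letters in \<open>T\<close> but not
  its first \<open>v + 1\<close>. It makes prefix length \<open>v\<close> available; at length
  \<open>v + 1\<close> it fails, and the orderings of \<open>T\<close> fail already at
  \<open>v\<close>.\<close>

lemma level_increase_by_ordering:
  assumes T: "T \<subseteq> ground k" "\<not> letters k \<subseteq> T"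
    and v: "level k T = v" "Suc v < k - 1" "v \<le> card {s. Inl s \<in> T}"
  shows "\<exists>T'. T \<subseteq> T' \<and> T' \<subseteq> ground k \<and> T' \<noteq> letters k \<and> level k T' = Suc v"
proof -
  have "{s. Inl s \<in> T} \<subset> {..<k}"
    using T by (auto simp: ground_def letters_def)
  then obtain q where q: "q \<in> orderings k" "set (take v q) \<subseteq> {s. Inl s \<in> T}"
    "\<not> set (take (Suc v) q) \<subseteq> {s. Inl s \<in> T}"
    using ordering_with_prefix v by meson
  have "\<not> prefix_in v T"
    using less_level_iff[of v k T] v by simp
  then have "\<not> prefix_in (Suc v) T"
    using prefix_in_antimono[of "Suc v" T v] by auto
  then have "\<not> prefix_in (Suc v) (insert (Inr q) T)"
    using q(3) unfolding prefix_in_def by auto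
  moreover have "prefix_in v (insert (Inr q) T)"
    using q(2) unfolding prefix_in_def by auto
  ultimately have "level k (insert (Inr q) T) = Suc v"
    using v by (intro level_eqI) auto
  then show ?thesis
    using q(1) T by (intro exI[of _ "insert (Inr q) T"]) (auto simp: ground_def letters_def)
qed

text \<open>With enough letters an ordering is added. Otherwise level \<open>v\<close> forces
  exactly \<open>v - 1\<close> letters, and a letter is added: either this alone raises the level to
  \<open>v + 1\<close>, or there are now \<open>v\<close> letters and an ordering can be added.
  Raising by exactly one ensures that \<open>gadget_high_chain\<close> skips no level.\<close>

lemma level_increase:
  assumes T: "T \<subseteq> ground k" "T \<noteq> letters k" and v: "Suc (level k T) < k - 1"
  shows "\<exists>T'. T \<subseteq> T' \<and> T' \<subseteq> ground k \<and> T' \<noteq> letters k \<and> level k T' = Suc (level k T)"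
proof (cases "level k T \<le> card {s. Inl s \<in> T}")
  case True
  moreover have "\<not> letters k \<subseteq> T"
    using level_above_letters[of k T] T v by auto
  ultimately show ?thesis
    using level_increase_by_ordering T v by blast
next
  case False
  define v where "v = level k T"
  define U where "U = {s. Inl s \<in> T}"
  have U: "U \<subseteq> {..<k}"
    using T by (auto simp: U_def ground_def letters_def)
  have fin: "finite U"
    using U finite_subset by blast
  have prefix: "prefix_in (v - 1) T"
    using less_level_iff[of "v - 1" k T] False assms(3) v_def by auto
  then obtain q0 where q0: "Inr q0 \<in> T" "set (take (v - 1) q0) \<subseteq> U"
    unfolding prefix_in_def U_def by auto
  have card_take: "card (set (take j q)) = j" if "Inr q \<in> ground k" "j \<le> k" for j q
  proof -
    have "q \<in> orderings k"
      using that by (auto simp: ground_def letters_def)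
    then show ?thesis
      using length_orderings[of q k] that
      by (simp add: distinct_card orderings_def)
  qed
  have "v - 1 \<le> card U"
    using card_mono[OF fin q0(2)] card_take[of q0 "v - 1"] q0 T assms(3) v_def by auto
  then have cU: "card U = v - 1" "v > 0"
    using False v_def U_def by auto
  have "card U < k"
    using cU assms(3) v_def by linarith
  then have "\<not> {..<k} \<subseteq> U"
    using card_mono[OF fin, of "{..<k}"] by auto
  then obtain s where s: "s < k" "s \<notin> U"
    by auto
  define T1 where "T1 = insert (Inl s) T"
  have U1: "{s. Inl s \<in> T1} = insert s U"
    by (auto simp: T1_def U_def)
  have cU1: "card {s. Inl s \<in> T1} = v"
    unfolding U1 using cU s fin by simp
  have T1: "T1 \<subseteq> ground k" "T1 \<noteq> letters k" "T \<subseteq> T1"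
    using T s q0 by (auto simp: T1_def ground_def letters_def)
  have lv: "Suc v < k - 1"
    using assms(3) v_def by simp
  \<comment> \<open>\<open>T1\<close> has only \<open>v\<close> letters, while a prefix of length
    \<open>v + 1\<close> needs one more.\<close>
  have nP: "\<not> prefix_in (Suc v) T1"
  proof
    assume "prefix_in (Suc v) T1"
    then obtain q where q: "Inr q \<in> T1" "set (take (Suc v) q) \<subseteq> {s. Inl s \<in> T1}"
      unfolding prefix_in_def by auto
    have "finite {s. Inl s \<in> T1}"
      unfolding U1 using fin by simp
    from card_mono[OF this q(2)] have "card (set (take (Suc v) q)) \<le> v"
      using cU1 by simp
    moreover have "card (set (take (Suc v) q)) = Suc v"
      using q(1) T1(1) lv by (intro card_take) auto
    ultimately show False
      by simp
  qed
  show ?thesis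
  proof (cases "prefix_in v T1")
    case True
    then have "level k T1 = Suc v"
      using nP lv by (intro level_eqI) auto
    then show ?thesis
      using T1 v_def by blast
  next
    case False
    then have l1: "level k T1 = v"
      using lv prefix_in_mono[OF prefix T1(3)] by (intro level_eqI) auto
    moreover have "\<not> letters k \<subseteq> T1"
      using level_above_letters[of k T1] T1 l1 lv by auto
    ultimately show ?thesis
      using level_increase_by_ordering[of T1 k v] T1 cU1 lv v_def by (metis order_refl order_trans)
  qed
qed

section \<open>The two layers of the gadget\<close>

text \<open>Minimal witnesses: for \<open>j < k - 1\<close>, a set
  \<open>T \<subseteq> ground k\<close> satisfies \<open>prefix_in j T\<close> iff it contains a
  member formed with that \<open>j\<close>.\<close>

definition gadget_low :: "nat \<Rightarrow> (nat + nat list) set set" where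
  "gadget_low k = {insert (Inr q) (Inl ` set (take j q)) | q j. q \<in> orderings k \<and> j < k - 1}"

text \<open>The upper half consists of the sets that are maximal within their level; \<open>letters k\<close>
  is left out of the ground poset because its interval is refined by the next block.\<close>

definition gadget_high :: "nat \<Rightarrow> (nat + nat list) set set" where
  "gadget_high k = {Y. Y \<subseteq> ground k \<and> Y \<noteq> letters k \<and> level k Y < k - 1 \<and>
     (\<forall>Y'. Y \<subset> Y' \<and> Y' \<subseteq> ground k \<and> Y' \<noteq> letters k \<longrightarrow> level k Y < level k Y')}"

text \<open>Alternately enlarge to a maximal set of the same level, which belongs to
  \<open>gadget_high k\<close>, and raise the level by one. Every level from that of
  \<open>T\<close> up to \<open>k - 2\<close> contributes one set.\<close>

lemma gadget_high_chain:
  assumes "T \<subseteq> ground k" "T \<noteq> letters k"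
  shows "\<exists>Y. (\<forall>j. level k T \<le> j \<and> j < k - 1 \<longrightarrow> Y j \<in> gadget_high k \<and> T \<subseteq> Y j) \<and>
    (\<forall>j j'. level k T \<le> j \<and> j < j' \<and> j' < k - 1 \<longrightarrow> Y j \<subset> Y j')"
  using assms
proof (induction "k - 1 - level k T" arbitrary: T)
  case 0
  then show ?case
    by auto
next
  case (Suc d)
  define v where "v = level k T"
  have v: "v < k - 1"
    using Suc.hyps(2) v_def by linarith
  define \<Y> where "\<Y> = {Y. T \<subseteq> Y \<and> Y \<subseteq> ground k \<and> Y \<noteq> letters k \<and> level k Y = v}"
  have "finite \<Y>"
    unfolding \<Y>_def by (rule finite_subset[of _ "Pow (ground k)"]) (auto simp: finite_ground)
  moreover have "T \<in> \<Y>"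
    using Suc.prems v_def \<Y>_def by simp
  ultimately have "\<exists>Z\<in>\<Y>. T \<subseteq> Z \<and> (\<forall>Y\<in>\<Y>. Z \<subseteq> Y \<longrightarrow> Z = Y)"
    by (rule finite_has_maximal2)
  then obtain Z where "Z \<in> \<Y>" and mx: "\<forall>Y\<in>\<Y>. Z \<subseteq> Y \<longrightarrow> Z = Y"
    by (elim bexE conjE)
  then have Z: "T \<subseteq> Z" "Z \<subseteq> ground k" "Z \<noteq> letters k" "level k Z = v"
    by (simp_all add: \<Y>_def)
  have "level k Z < level k Y" if "Z \<subset> Y" "Y \<subseteq> ground k" "Y \<noteq> letters k" for Y
  proof (rule ccontr)
    assume "\<not> level k Z < level k Y"
    then have "Y \<in> \<Y>"
      using level_mono[of Z Y k] that Z by (simp add: \<Y>_def)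
    then show False
      using mx that(1) by blast
  qed
  then have Zhigh: "Z \<in> gadget_high k"
    using Z v by (simp add: gadget_high_def)
  show ?case
  proof (cases "Suc v < k - 1")
    case False
    then have "j = v" if "v \<le> j" "j < k - 1" for j
      using that by linarith
    then show ?thesis
      using Zhigh Z(1) False unfolding v_def[symmetric]
      by (intro exI[of _ "\<lambda>_. Z"]) auto
  next
    case True
    obtain T' where T': "Z \<subseteq> T'" "T' \<subseteq> ground k" "T' \<noteq> letters k" "level k T' = Suc v"
      using level_increase[of Z k] Z True by auto
    have "d = k - 1 - level k T'"
      using Suc.hyps(2) T'(4) v_def by linarith
    from Suc.hyps(1)[OF this T'(2,3)] obtain Y
      where Y: "\<forall>j. Suc v \<le> j \<and> j < k - 1 \<longrightarrow> Y j \<in> gadget_high k \<and> T' \<subseteq> Y j"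
      and Ymono: "\<forall>j j'. Suc v \<le> j \<and> j < j' \<and> j' < k - 1 \<longrightarrow> Y j \<subset> Y j'"
      unfolding T'(4) by (elim exE conjE)
    have "Z \<subset> T'"
      using T' Z by auto
    then have "(if j = v then Z else Y j) \<subset> (if j' = v then Z else Y j')"
      if "v \<le> j" "j < j'" "j' < k - 1" for j j'
      using Y[rule_format, of j'] Ymono[rule_format, of j j'] that by (auto split: if_splits)
    moreover have "(if j = v then Z else Y j) \<in> gadget_high k \<and> T \<subseteq> (if j = v then Z else Y j)"
      if "v \<le> j" "j < k - 1" for j
      using Zhigh Z(1) Y[rule_format, of j] T'(1) that by (cases "j = v") (simp_all, blast)
    ultimately show ?thesis
      unfolding v_def[symmetric] by (intro exI[of _ "\<lambda>j. if j = v then Z else Y j"]) blast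
  qed
qed

lemma chain_gadget_orderings:
  assumes "k \<ge> 1"
  shows "chain_gadget k (ground k) (letters k) (gadget_low k) (gadget_high k)
    (\<lambda>X. card {s. Inl s \<in> X}) (level k)"
proof
  have card_low: "card {s. Inl s \<in> insert (Inr q) (Inl ` set (take j q))} = j"
    if "q \<in> orderings k" "j < k - 1" for q j
  proof -
    have "{s. (Inl s :: nat + nat list) \<in> insert (Inr q) (Inl ` set (take j q))} = set (take j q)"
      by auto
    then show ?thesis
      using that length_orderings[of q k] by (simp add: distinct_card orderings_def)
  qed
  show "finite (ground k)"
    by (rule finite_ground)
  have "[0..<k] \<in> orderings k"
    by (auto simp: orderings_def)
  then show "letters k \<subset> ground k"
    by (auto simp: ground_def letters_def)
  show "letters k \<noteq> {}"
    using assms by (auto simp: letters_def lessThan_empty_iff)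
  show "X \<subseteq> ground k \<and> \<not> X \<subseteq> letters k" if X: "X \<in> gadget_low k" for X
  proof -
    obtain q j where "X = insert (Inr q) (Inl ` set (take j q))" "q \<in> orderings k"
      using X by (auto simp: gadget_low_def)
    moreover from this have "set (take j q) \<subseteq> {..<k}"
      using set_take_subset[of j q] by (simp add: orderings_def)
    ultimately show ?thesis
      by (auto simp: ground_def letters_def)
  qed
  show "Y \<subseteq> ground k \<and> \<not> letters k \<subseteq> Y" if "Y \<in> gadget_high k" for Y
    using that level_above_letters[of k Y] by (auto simp: gadget_high_def)
  show "card {s. Inl s \<in> X} < k - 1" if "X \<in> gadget_low k" for X
    using that card_low by (auto simp: gadget_low_def)
  show "level k Y < k - 1" if "Y \<in> gadget_high k" for Y
    using that by (simp add: gadget_high_def)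
  show "card {s. Inl s \<in> X} < card {s. Inl s \<in> X'}"
    if X: "X \<in> gadget_low k" and X': "X' \<in> gadget_low k" and "X \<subset> X'" for X X'
  proof (rule psubset_card_mono)
    obtain q j q' j' where
      eq: "X = insert (Inr q) (Inl ` set (take j q))" "X' = insert (Inr q') (Inl ` set (take j' q'))"
      using X X' by (auto simp: gadget_low_def)
    have "{s. Inl s \<in> X'} = set (take j' q')"
      using eq by auto
    then show "finite {s. Inl s \<in> X'}"
      by simp
    \<comment> \<open>Each low set contains just one ordering, so the strict inclusion must come
      from the letters.\<close>
    have "q = q'"
      using eq \<open>X \<subset> X'\<close> by auto
    then show "{s. Inl s \<in> X} \<subset> {s. Inl s \<in> X'}"
      using eq \<open>X \<subset> X'\<close> by auto
  qed
  show "card {s. Inl s \<in> X} < level k Y"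
    if X: "X \<in> gadget_low k" and Y: "Y \<in> gadget_high k" and "X \<subseteq> Y" for X Y
  proof -
    obtain q j where q: "X = insert (Inr q) (Inl ` set (take j q))" "q \<in> orderings k" "j < k - 1"
      using X by (auto simp: gadget_low_def)
    \<comment> \<open>\<open>X\<close> is itself a witness for prefix length \<open>j\<close> in
      \<open>Y\<close>, which pushes the level of \<open>Y\<close> above \<open>j\<close>.\<close>
    then have "prefix_in j Y"
      using \<open>X \<subseteq> Y\<close> unfolding prefix_in_def by blast
    then show ?thesis
      using less_level_iff[of j k Y] q card_low by simp
  qed
  show "level k Y < level k Y'"
    if "Y \<in> gadget_high k" "Y' \<in> gadget_high k" "Y \<subset> Y'" for Y Y'
    using that by (auto simp: gadget_high_def)
  fix T assume T: "T \<subseteq> ground k" "T \<noteq> letters k"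
  \<comment> \<open>A trace of level \<open>v\<close> has \<open>v\<close> low sets below it, from
    the prefixes of lengths \<open>0\<close> to \<open>v - 1\<close> of a single ordering, and
    \<open>k - 1 - v\<close> high sets above it.\<close>
  define v where "v = level k T"
  have "v < k"
    using level_le[of k T] assms v_def by linarith
  obtain Y where Y: "\<forall>j. v \<le> j \<and> j < k - 1 \<longrightarrow> Y j \<in> gadget_high k \<and> T \<subseteq> Y j"
    "\<forall>j j'. v \<le> j \<and> j < j' \<and> j' < k - 1 \<longrightarrow> Y j \<subset> Y j'"
    using gadget_high_chain[OF T] v_def by blast
  have "\<exists>X. (\<forall>j<v. X j \<in> gadget_low k \<and> X j \<subseteq> T) \<and> (\<forall>j j'. j < j' \<and> j' < v \<longrightarrow> X j \<subset> X j')"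
  proof (cases "v = 0")
    case False
    then have "prefix_in (v - 1) T"
      using less_level_iff[of "v - 1" k T] level_le[of k T] v_def by auto
    then obtain q where q: "Inr q \<in> T" "Inl ` set (take (v - 1) q) \<subseteq> T"
      unfolding prefix_in_def by blast
    have qo: "q \<in> orderings k"
      using q T by (auto simp: ground_def letters_def)
    define X :: "nat \<Rightarrow> (nat + nat list) set"
      where "X j = insert (Inr q) (Inl ` set (take j q))" for j
    have vk: "v \<le> k - 1"
      using level_le v_def by simp
    have "X j \<in> gadget_low k \<and> X j \<subseteq> T" if "j < v" for j
    proof -
      have "set (take j q) \<subseteq> set (take (v - 1) q)"
        using that by (intro set_take_subset_set_take) simp
      then show ?thesis
        using q qo that vk unfolding X_def gadget_low_def by fastforce
    qed
    moreover have "X j \<subset> X j'" if "j < j'" "j' < v" for j j'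
    proof -
      have "X j \<subseteq> X j'"
        unfolding X_def using set_take_subset_set_take[of j j' q] that by auto
      moreover have "X j \<noteq> X j'"
        using card_low[OF qo, of j] card_low[OF qo, of j'] that vk X_def
        by (metis less_irrefl less_le_trans less_trans)
      ultimately show ?thesis
        by blast
    qed
    ultimately show ?thesis
      by (intro exI[of _ X]) simp
  qed simp
  then obtain X where "\<forall>j<v. X j \<in> gadget_low k \<and> X j \<subseteq> T"
    "\<forall>j j'. j < j' \<and> j' < v \<longrightarrow> X j \<subset> X j'"
    by (elim exE conjE)
  with \<open>v < k\<close> Y show "\<exists>v X Y. v < k \<and>
      (\<forall>j<v. X j \<in> gadget_low k \<and> X j \<subseteq> T) \<and>
      (\<forall>j. v \<le> j \<and> j < k - 1 \<longrightarrow> Y j \<in> gadget_high k \<and> T \<subseteq> Y j) \<and>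
      (\<forall>j j'. j < j' \<and> j' < v \<longrightarrow> X j \<subset> X j') \<and>
      (\<forall>j j'. v \<le> j \<and> j < j' \<and> j' < k - 1 \<longrightarrow> Y j \<subset> Y j')"
    by (intro exI[of _ v] exI[of _ X] exI[of _ Y]) simp
qed

section \<open>Stacking gadgets\<close>

lemma has_chainsI:
  assumes "\<And>i j. i < m \<Longrightarrow> j < k \<Longrightarrow> D i j \<in> F"
    and "\<And>i j j'. i < m \<Longrightarrow> j < j' \<Longrightarrow> j' < k \<Longrightarrow> D i j < D i j'"
    and "\<And>i i' j j'. i < m \<Longrightarrow> i' < m \<Longrightarrow> i \<noteq> i' \<Longrightarrow> j < k \<Longrightarrow> j' < k \<Longrightarrow> \<not> D i j \<le> D i' j'"
  shows "has_chains m k F"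
  unfolding has_chains_def
proof (intro exI[of _ D] conjI allI impI)
  fix i j i' j' assume *: "i < m" "j < k" "i' < m" "j' < k"
  consider "i \<noteq> i'" | "i = i'" "j < j'" | "i = i'" "j = j'" | "i = i'" "j' < j"
    by linarith
  then show "D i j \<le> D i' j' \<longleftrightarrow> i = i' \<and> j \<le> j'"
  proof cases
    case 4
    then show ?thesis
      using assms(2)[of i j' j] * by (auto simp: not_le)
  qed (use * assms(2)[of i j j'] assms(3)[of i i' j j'] in \<open>auto simp: less_imp_le\<close>)
qed (use assms in blast)

text \<open>Subsets of a ground set consisting of \<open>l\<close> blocks \<open>N\<close> and a final block \<open>R\<close> are represented
  by the functions giving the trace on each block, ordered pointwise.\<close>

locale gadget_stack = chain_gadget k N S A0 A1 lab0 lab1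
  for k :: nat and N S :: "'g set" and A0 A1 lab0 lab1 +
  fixes l m :: nat and R P :: "'g set"
  assumes finite_R: "finite R" and P_subset: "P \<subset> R" and card_P: "Suc (card P) = m"
begin

text \<open>Empty blocks beyond \<open>l\<close> make every member of \<open>box\<close> vanish
  there, so the pointwise order only depends on the real blocks.\<close>

definition block :: "nat \<Rightarrow> 'g set" where
  "block i = (if i < l then N else if i = l then R else {})"

definition box :: "(nat \<Rightarrow> 'g set) set" where
  "box = {f. \<forall>i. f i \<subseteq> block i}"

text \<open>Among the members of \<open>box\<close> with trace \<open>S\<close> before block
  \<open>i\<close> and \<open>X\<close> on it, this is the least one if \<open>b\<close> is false
  and the greatest one if \<open>b\<close> is true.\<close>

definition cell :: "nat \<Rightarrow> 'g set \<Rightarrow> bool \<Rightarrow> nat \<Rightarrow> 'g set" where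
  "cell i X b j = (if j < i then S else if j = i then X else if b then block j else {})"

definition cells :: "(nat \<Rightarrow> 'g set) set" where
  "cells = {cell i X b | i X b. i < l \<and> X \<in> (if b then A1 else A0)}"

definition rail :: "nat \<Rightarrow> 'g set \<Rightarrow> 'g \<Rightarrow> nat \<Rightarrow> 'g set" where
  "rail u w p j = (if j < u then S else if j < l then w else if j = l then {p} else {})"

definition rails :: "'g \<Rightarrow> (nat \<Rightarrow> 'g set) set" where
  "rails p = {rail u w p | u w. u \<le> l \<and> w \<in> {{}, N}}"

definition family :: "(nat \<Rightarrow> 'g set) set" where
  "family = cells \<union> (\<Union>p\<in>P. rails p)"

text \<open>Only \<open>i\<close>, \<open>w\<close>, the traces on the \<open>k\<close> blocks from
  \<open>i\<close> on and the trace on \<open>R\<close> can vary, so for blocks of bounded size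
  there are \<open>O(l)\<close> such functions.\<close>

definition exceptional :: "(nat \<Rightarrow> 'g set) set" where
  "exceptional = {f \<in> box. \<exists>i\<le>l. (\<forall>j<i. f j = S) \<and>
     (\<exists>w\<in>{{}, N}. \<forall>j. i + k \<le> j \<and> j < l \<longrightarrow> f j = w)}"

lemma cell_in_cells: "i < l \<Longrightarrow> X \<in> (if b then A1 else A0) \<Longrightarrow> cell i X b \<in> cells"
  unfolding cells_def by blast

lemma rail_in_rails: "u \<le> l \<Longrightarrow> w \<in> {{}, N} \<Longrightarrow> rail u w p \<in> rails p"
  unfolding rails_def by blast

lemma k_pos: "k > 0"
  using saturated[of "{}"] S_nonempty by auto

lemma S_sub_N: "S \<subseteq> N"
  using S_subset by blast

section \<open>Height of the cells\<close>

text \<open>Comparable cells deviate in the same block, where the gadget labels apply. If the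
  smaller one deviated first, \<open>X \<subseteq> S\<close> would make it high, hence both high
  with \<open>N \<subseteq> X'\<close>; if the larger one did, \<open>S \<subseteq> X'\<close> would
  make it low, hence both low with \<open>X\<close> empty. Neither fits the conditions on
  \<open>A0\<close> and \<open>A1\<close>.\<close>

lemma cell_less_imp_label_less:
  assumes "i < l" "i' < l"
    and X: "X \<in> (if b then A1 else A0)" and X': "X' \<in> (if b' then A1 else A0)"
    and less: "cell i X b < cell i' X' b'"
  shows "(if b then lab1 X else lab0 X) < (if b' then lab1 X' else lab0 X')"
proof -
  have le: "cell i X b j \<subseteq> cell i' X' b' j" for j
    using less by (simp add: le_fun_def less_le)
  \<comment> \<open>On the final block a high cell has trace \<open>R\<close> and a low cell is
    empty, so no high cell lies below a low one.\<close>
  have "R \<noteq> {}"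
    using P_subset by blast
  then have b_imp: b' if b
    using le[of l] assms(1,2) that by (auto simp: cell_def block_def split: if_splits)
  have "i = i'"
  proof (rule ccontr)
    assume "i \<noteq> i'"
    then consider "i < i'" | "i' < i"
      by linarith
    then show False
    proof cases
      case 1
      then have "X \<subseteq> S"
        using le[of i] by (simp add: cell_def)
      then have b
        using X A0[of X] by (auto split: if_splits)
      then have "N \<subseteq> X'"
        using 1 le[of i'] assms(2) by (simp add: cell_def block_def)
      then show False
        using b_imp[OF \<open>b\<close>] X' A1[of X'] S_sub_N by auto
    next
      case 2
      then have "S \<subseteq> X'"
        using le[of i'] by (simp add: cell_def)
      then have "\<not> b'"
        using X' A1[of X'] by (auto split: if_splits)
      then have "X \<subseteq> {}" "\<not> b"
        using 2 le[of i] b_imp by (auto simp: cell_def)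
      then show False
        using X A0[of X] by auto
    qed
  qed
  have sub: "X \<subseteq> X'"
    using le[of i] \<open>i = i'\<close> by (simp add: cell_def)
  have "b \<noteq> b' \<or> X \<noteq> X'"
    using less \<open>i = i'\<close> by (cases "b = b' \<and> X = X'") auto
  then show ?thesis
    using sub b_imp X X' lab00[of X X'] lab01[of X X'] lab11[of X X']
    by (cases b; cases b') (simp_all add: psubset_eq)
qed

text \<open>Labels strictly increase along a chain of cells and stay below
  \<open>k - 1\<close>.\<close>

lemma no_long_chain_in_cells:
  assumes "\<And>j. j < k \<Longrightarrow> c j \<in> cells" "\<And>j. Suc j < k \<Longrightarrow> c j < c (Suc j)"
  shows False
proof -
  have "\<forall>j. \<exists>i X b. j < k \<longrightarrow> i < l \<and> X \<in> (if b then A1 else A0) \<and> c j = cell i X b"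
    using assms(1) unfolding cells_def by blast
  then obtain i X b where t: "\<And>j. j < k \<Longrightarrow>
      i j < l \<and> X j \<in> (if b j then A1 else A0) \<and> c j = cell (i j) (X j) (b j)"
    by metis
  define lab where "lab j = (if b j then lab1 (X j) else lab0 (X j))" for j
  have step: "lab j < lab (Suc j)" if "Suc j < k" for j
    unfolding lab_def using t[of j] t[of "Suc j"] assms(2)[of j] that
    by (intro cell_less_imp_label_less) auto
  have "j \<le> lab j" if "j < k" for j
    using that
  proof (induction j)
    case (Suc j)
    then show ?case
      using step[of j] by simp
  qed simp
  then have "k - 1 \<le> lab (k - 1)"
    using k_pos by simp
  moreover have "lab (k - 1) < k - 1"
    using t[of "k - 1"] k_pos lab0_less lab1_less by (auto simp: lab_def split: if_splits)
  ultimately show False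
    by simp
qed

section \<open>Rails and the family without incomparable chains\<close>

text \<open>The chain ascends from \<open>rail 0 {} p\<close> with growing \<open>u\<close> to
  \<open>rail l w p\<close>, which is the same for both \<open>w\<close>, and then with falling
  \<open>u\<close> to \<open>rail 0 N p\<close>.\<close>

lemma rails_comparable: "f \<in> rails p \<Longrightarrow> g \<in> rails p \<Longrightarrow> f \<le> g \<or> g \<le> f"
proof -
  assume "f \<in> rails p" "g \<in> rails p"
  then obtain u w u' w' where f: "f = rail u w p" "u \<le> l" "w \<in> {{}, N}"
    and g: "g = rail u' w' p" "u' \<le> l" "w' \<in> {{}, N}"
    unfolding rails_def by blast
  have 1: "rail u {} p \<le> rail u' {} p" if "u \<le> u'" "u' \<le> l" for u u'
    using that by (auto simp: le_fun_def rail_def)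
  have 2: "rail u {} p \<le> rail u' N p" if "u \<le> l" "u' \<le> l" for u u'
    using that S_sub_N by (auto simp: le_fun_def rail_def)
  have 3: "rail u' N p \<le> rail u N p" if "u \<le> u'" "u' \<le> l" for u u'
    using that S_sub_N by (auto simp: le_fun_def rail_def)
  show "f \<le> g \<or> g \<le> f"
    using f g 1[of u u'] 1[of u' u] 2[of u u'] 2[of u' u] 3[of u u'] 3[of u' u]
    by (cases "u \<le> u'") auto
qed

text \<open>Each of the \<open>m - 1\<close> rails is a chain and so meets only one of \<open>m\<close> incomparable chains;
  hence one of them consists of cells only.\<close>

lemma family_has_no_chains: "\<not> has_chains m k family"
proof
  assume "has_chains m k family"
  then obtain D where D: "\<forall>i<m. \<forall>j<k. D i j \<in> family"
    and ord: "\<forall>i<m. \<forall>j<k. \<forall>i'<m. \<forall>j'<k. D i j \<le> D i' j' \<longleftrightarrow> i = i' \<and> j \<le> j'"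
    unfolding has_chains_def by (elim exE conjE)
  have "\<exists>j p. j < k \<and> p \<in> P \<and> D i j \<in> rails p" if i: "i < m" for i
  proof (rule ccontr)
    assume "\<not> ?thesis"
    then have "D i j \<in> cells" if "j < k" for j
      using D i that by (auto simp: family_def)
    moreover have "D i j < D i (Suc j)" if "Suc j < k" for j
      using ord i that by (simp add: less_le_not_le)
    ultimately show False
      by (rule no_long_chain_in_cells)
  qed
  then obtain J p where J: "\<And>i. i < m \<Longrightarrow> J i < k \<and> p i \<in> P \<and> D i (J i) \<in> rails (p i)"
    by metis
  have "inj_on p {..<m}"
  proof (rule inj_onI)
    fix i i' assume "i \<in> {..<m}" "i' \<in> {..<m}" "p i = p i'"
    then show "i = i'"
      using J[of i] J[of i'] rails_comparable[of "D i (J i)" "p i" "D i' (J i')"] ord by auto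
  qed
  moreover have "p ` {..<m} \<subseteq> P"
    using J by auto
  moreover have "finite P"
    using P_subset finite_R finite_subset by blast
  ultimately have "m \<le> card P"
    by (metis card_inj_on_le card_lessThan)
  then show False
    using card_P by simp
qed

lemma family_subset_box: "family \<subseteq> box"
proof -
  have "cell i X b \<in> box" if "i < l" "X \<in> (if b then A1 else A0)" for i X b
    using that S_sub_N A0[of X] A1[of X] by (auto simp: box_def cell_def block_def split: if_splits)
  moreover have "rail u w p \<in> box" if "u \<le> l" "w \<in> {{}, N}" "p \<in> P" for u w p
    using that S_sub_N P_subset by (auto simp: box_def rail_def block_def)
  ultimately show ?thesis
    unfolding family_def cells_def rails_def by blast
qed

text \<open>Hence a non-exceptional \<open>f\<close> is not a cell, which makes its inclusions in
  the gadget chain strict. A cell qualifies through its own block \<open>i\<close>, a rail member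
  through \<open>i = u\<close>.\<close>

lemma family_subset_exceptional: "family \<subseteq> exceptional"
proof
  fix f assume f: "f \<in> family"
  have "\<exists>i\<le>l. (\<forall>j<i. f j = S) \<and> (\<exists>w\<in>{{}, N}. \<forall>j. i + k \<le> j \<and> j < l \<longrightarrow> f j = w)"
  proof (cases "f \<in> cells")
    case True
    then obtain i X b where f: "f = cell i X b" "i < l"
      unfolding cells_def by blast
    show ?thesis
      using f k_pos
      by (intro exI[of _ i] conjI bexI[of _ "if b then N else {}"]) (auto simp: cell_def block_def)
  next
    case False
    then obtain u w p where f: "f = rail u w p" "u \<le> l" "w \<in> {{}, N}"
      using f unfolding family_def rails_def by blast
    show ?thesis
      using f by (intro exI[of _ u] conjI bexI[of _ w]) (auto simp: rail_def)
  qed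
  then show "f \<in> exceptional"
    using f family_subset_box by (auto simp: exceptional_def)
qed

section \<open>Completing the chains with a non-exceptional set\<close>

text \<open>One chain passes through \<open>f\<close> and cells of the block where \<open>f\<close>
  first leaves \<open>S\<close>; the other \<open>m - 1\<close> are stretches of \<open>k\<close>
  rail members.\<close>

lemma insert_has_chains:
  assumes f: "f \<in> box" "f \<notin> exceptional"
  shows "has_chains m k (insert f family)"
proof -
  define i where "i = (LEAST i. i \<ge> l \<or> f i \<noteq> S)"
  have below: "f j = S" if "j < i" for j
    using that not_less_Least unfolding i_def by blast
  have i_prop: "i \<ge> l \<or> f i \<noteq> S"
    unfolding i_def by (rule LeastI[of _ l]) simp
  have "i \<le> l"
    unfolding i_def by (rule Least_le) simp
  \<comment> \<open>Otherwise \<open>i\<close> and \<open>w\<close> would show \<open>f\<close> to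
    be exceptional. So \<open>f\<close> is somewhere nonempty and somewhere not full beyond the
    window, which is what separates it from the rails.\<close>
  have tail: "\<exists>j. i + k \<le> j \<and> j < l \<and> f j \<noteq> w" if w: "w \<in> {{}, N}" for w
  proof (rule ccontr)
    assume "\<not> ?thesis"
    then have "\<forall>j. i + k \<le> j \<and> j < l \<longrightarrow> f j = w"
      by simp
    then have "f \<in> exceptional"
      unfolding exceptional_def using f(1) below \<open>i \<le> l\<close> w
      by (intro CollectI conjI exI[of _ i] bexI[of _ w]) simp_all
    with f(2) show False
      by contradiction
  qed
  obtain j1 where j1: "i + k \<le> j1" "j1 < l" "f j1 \<noteq> {}"
    using tail[of "{}"] by auto
  obtain j2 where j2: "i + k \<le> j2" "j2 < l" "f j2 \<noteq> N"
    using tail[of N] by auto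
  have "i < l"
    using j1 by linarith
  then have "f i \<noteq> S"
    using i_prop by simp
  have fN: "f j \<subseteq> N" if "j < l" for j
    using f(1) that by (auto simp: box_def block_def split: if_splits)
  have fb: "f j \<subseteq> block j" for j
    using f(1) by (auto simp: box_def)
  obtain v X Y where "v < k" and X: "\<forall>j<v. X j \<in> A0 \<and> X j \<subseteq> f i"
    and Y: "\<forall>j. v \<le> j \<and> j < k - 1 \<longrightarrow> Y j \<in> A1 \<and> f i \<subseteq> Y j"
    and X_mono: "\<forall>j j'. j < j' \<and> j' < v \<longrightarrow> X j \<subset> X j'"
    and Y_mono: "\<forall>j j'. v \<le> j \<and> j < j' \<and> j' < k - 1 \<longrightarrow> Y j \<subset> Y j'"
    using saturated[OF fN[OF \<open>i < l\<close>] \<open>f i \<noteq> S\<close>] by (elim exE conjE)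
  \<comment> \<open>There are \<open>v\<close> low cells, \<open>f\<close>, and
    \<open>k - 1 - v\<close> high cells; as \<open>f\<close> takes position \<open>v\<close>, the
    high cells are shifted by one.\<close>
  define c where "c j = (if j < v then cell i (X j) False else if j = v then f
    else cell i (Y (j - 1)) True)" for j
  have low: "cell i (X j) False \<in> cells" if "j < v" for j
    using X that \<open>i < l\<close> by (intro cell_in_cells) simp_all
  have high: "cell i (Y j) True \<in> cells" if "v \<le> j" "j < k - 1" for j
    using Y that \<open>i < l\<close> by (intro cell_in_cells) simp_all
  have c_in: "c j \<in> insert f cells" if "j < k" for j
    using low[of j] high[of "j - 1"] that by (auto simp: c_def)
  have "f \<notin> cells"
    using f(2) family_subset_exceptional by (auto simp: family_def)
  have low_less: "cell i (X j) False < f" if "j < v" for j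
  proof -
    have "cell i (X j) False \<le> f"
      using X that below by (auto simp: le_fun_def cell_def)
    then show ?thesis
      using low[OF that] \<open>f \<notin> cells\<close> by (auto simp: less_le)
  qed
  have less_high: "f < cell i (Y j) True" if "v \<le> j" "j < k - 1" for j
  proof -
    have "f \<le> cell i (Y j) True"
      using Y that below fb by (auto simp: le_fun_def cell_def)
    then show ?thesis
      using high[OF that] \<open>f \<notin> cells\<close> by (auto simp: less_le)
  qed
  have cell_mono: "cell i Z b < cell i Z' b" if "Z \<subset> Z'" for Z Z' b
  proof -
    have "cell i Z b \<le> cell i Z' b"
      using that by (auto simp: le_fun_def cell_def)
    moreover have "cell i Z b i \<noteq> cell i Z' b i"
      using that by (simp add: cell_def)
    ultimately show ?thesis
      by (auto simp: less_le)
  qed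
  have c_mono: "c j < c j'" if jj: "j < j'" "j' < k" for j j'
  proof -
    consider "j' < v" | "j < v" "j' = v" | "j < v" "v < j'" | "j = v" "v < j'" | "v < j"
      using jj by linarith
    then show ?thesis
    proof cases
      case 1
      then show ?thesis
        using that X_mono by (simp add: c_def cell_mono)
    next
      case 2
      then show ?thesis
        by (simp add: c_def low_less)
    next
      case 3
      then have "cell i (X j) False < f" "f < cell i (Y (j' - 1)) True"
        using that by (auto intro!: low_less less_high)
      then have "cell i (X j) False < cell i (Y (j' - 1)) True"
        by (rule less_trans)
      then show ?thesis
        using 3 by (simp add: c_def)
    next
      case 4
      then show ?thesis
        using that less_high[of "j' - 1"] by (simp add: c_def)
    next
      case 5
      then have "Y (j - 1) \<subset> Y (j' - 1)"
        using that by (intro Y_mono[rule_format]) linarith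
      then show ?thesis
        using 5 that by (simp add: c_def cell_mono)
    qed
  qed
  \<comment> \<open>Block \<open>i\<close>, where the rail still has trace \<open>S\<close>, refutes
    one inclusion, and the final block, where it is \<open>{p}\<close>, the other. For high cells
    the two blocks swap roles.\<close>
  have low_rail: "\<not> cell i Z False \<le> rail u w p \<and> \<not> rail u w p \<le> cell i Z False"
    if "Z \<in> A0" "i < u" "u \<le> l" for Z u w p
  proof
    have "\<not> Z \<subseteq> S"
      using A0 that by blast
    then show "\<not> cell i Z False \<le> rail u w p"
      using that by (auto simp: le_fun_def cell_def rail_def intro!: exI[of _ i])
    show "\<not> rail u w p \<le> cell i Z False"
      using that \<open>i < l\<close> by (auto simp: le_fun_def cell_def rail_def intro!: exI[of _ l])
  qed
  have high_rail: "\<not> cell i Z True \<le> rail u w p \<and> \<not> rail u w p \<le> cell i Z True"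
    if "Z \<in> A1" "i < u" "u \<le> l" "p \<in> P" for Z u w p
  proof
    have "\<not> S \<subseteq> Z"
      using A1 that by blast
    then show "\<not> rail u w p \<le> cell i Z True"
      using that by (auto simp: le_fun_def cell_def rail_def intro!: exI[of _ i])
    \<comment> \<open>A point of \<open>R\<close> outside \<open>P\<close> differs from
      \<open>p\<close>.\<close>
    have "\<not> R \<subseteq> {p}"
      using P_subset that(4) by blast
    then show "\<not> cell i Z True \<le> rail u w p"
      using that \<open>i < l\<close> by (auto simp: le_fun_def cell_def rail_def block_def intro!: exI[of _ l])
  qed
  \<comment> \<open>These rail members leave \<open>S\<close> at a block from \<open>i + 1\<close>
    to \<open>i + k\<close>, so they have trace \<open>S\<close> on block \<open>i\<close> and a
    constant one on the blocks from \<open>i + k\<close> on. If \<open>S \<subseteq> f i\<close>,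
    then \<open>f\<close> escapes them on block \<open>i\<close>, and the constant \<open>N\<close>
    makes them escape \<open>f\<close> at \<open>j2\<close>; otherwise they escape \<open>f\<close>
    on block \<open>i\<close>, and \<open>f\<close> escapes the constant \<open>{}\<close> at
    \<open>j1\<close>. Counting down in the first case makes \<open>W\<close> increase with
    \<open>j\<close>.\<close>
  define W where "W p j = (if S \<subseteq> f i then rail (i + k - j) N p else rail (Suc i + j) {} p)" for p j
  have W_in: "W p j \<in> rails p" if "j < k" for p j
    using that j1 by (auto simp: W_def intro!: rail_in_rails)
  have W_mono: "W p j < W p j'" if "j < j'" "j' < k" for p j j'
  proof -
    have "W p j \<le> W p j'"
      using that j1 S_sub_N by (auto simp: W_def le_fun_def rail_def)
    \<comment> \<open>On this block exactly one of the two rail members still has trace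
      \<open>S\<close>.\<close>
    moreover have "W p j (if S \<subseteq> f i then i + k - j' else Suc i + j)
        \<noteq> W p j' (if S \<subseteq> f i then i + k - j' else Suc i + j)"
      using that j1 S_subset S_nonempty by (auto simp: W_def rail_def)
    ultimately show ?thesis
      by (auto simp: less_le)
  qed
  have W_incomp: "\<not> W p j \<le> W p' j'" if "p \<noteq> p'" "j < k" "j' < k" for p p' j j'
    using that j1 by (auto simp: W_def le_fun_def rail_def intro!: exI[of _ l])
  have f_W: "\<not> f \<le> W p j \<and> \<not> W p j \<le> f" if "j < k" for p j
  proof (cases "S \<subseteq> f i")
    case True
    then have "\<not> f i \<subseteq> S" "\<not> N \<subseteq> f j2"
      using \<open>f i \<noteq> S\<close> fN[OF j2(2)] j2(3) by auto
    moreover have "W p j i = S" "W p j j2 = N"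
      using True that j2 by (auto simp: W_def rail_def)
    ultimately show ?thesis
      unfolding le_fun_def by metis
  next
    case False
    moreover have "W p j i = S" "W p j j1 = {}"
      using False that j1 by (auto simp: W_def rail_def)
    ultimately show ?thesis
      using j1(3) unfolding le_fun_def by (metis subset_empty)
  qed
  have c_W: "\<not> c j \<le> W p j' \<and> \<not> W p j' \<le> c j" if "j < k" "j' < k" "p \<in> P" for j j' p
  proof -
    consider "j < v" | "j = v" | "v < j"
      by linarith
    then show ?thesis
    proof cases
      case 1
      then show ?thesis
        using low_rail[of "X j"] X that j1 by (simp add: c_def W_def)
    next
      case 2
      then show ?thesis
        using f_W that by (simp add: c_def)
    next
      case 3
      then have "v \<le> j - 1 \<and> j - 1 < k - 1"
        using that by linarith
      then have "Y (j - 1) \<in> A1"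
        using Y by blast
      then show ?thesis
        using high_rail[of "Y (j - 1)"] that j1 3 by (simp add: c_def W_def)
    qed
  qed
  have "finite P"
    using P_subset finite_R finite_subset by blast
  then obtain e where e: "bij_betw e {..<card P} P"
    using ex_bij_betw_nat_finite[of P] by (auto simp: atLeast0LessThan)
  have eP: "e r \<in> P" if "r < card P" for r
    using e that by (auto dest: bij_betwE)
  have e_inj: "e r \<noteq> e r'" if "r < card P" "r' < card P" "r \<noteq> r'" for r r'
    using e that by (auto simp: bij_betw_def inj_on_def)
  \<comment> \<open>Indices below \<open>card P = m - 1\<close> select rails; the one remaining
    index selects the chain through \<open>f\<close>.\<close>
  define D where "D r j = (if r < card P then W (e r) j else c j)" for r j
  show ?thesis
  proof (rule has_chainsI[of m k D])
    show "D r j \<in> insert f family" if "r < m" "j < k" for r j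
      using that c_in[of j] W_in[of j "e r"] eP[of r] by (auto simp: D_def family_def)
    show "D r j < D r j'" if "r < m" "j < j'" "j' < k" for r j j'
      using that c_mono W_mono by (simp add: D_def)
    show "\<not> D r j \<le> D r' j'" if "r < m" "r' < m" "r \<noteq> r'" "j < k" "j' < k" for r r' j j'
    proof -
      have "r < card P \<or> r' < card P"
        using that card_P by linarith
      then show ?thesis
        using that W_incomp[of "e r" "e r'" j j'] e_inj[of r r'] eP[of r] eP[of r']
          c_W[of j j' "e r'"] c_W[of j' j "e r"] by (auto simp: D_def)
    qed
  qed
qed

section \<open>Counting, and transfer to subsets of \<open>{1..n}\<close>\<close>

lemma card_exceptional:
  "finite exceptional \<and>
   card exceptional \<le> Suc l * (2 * (2 ^ (card N * k) * 2 ^ card R))"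
proof -
  \<comment> \<open>\<open>enc i w\<close> rebuilds an exceptional function from its window traces
    \<open>g\<close>, indexed relative to \<open>i\<close>, and its final trace
    \<open>r\<close>.\<close>
  define enc where "enc i w = (\<lambda>(g, r) j. if j < i then S else if j < l then
      (if j < i + k then g (j - i) else w) else if j = l then r else {})"
    for i and w :: "'g set" and g :: "nat \<Rightarrow> 'g set" and r :: "'g set"
  define A where "A = ({..<k} \<rightarrow>\<^sub>E Pow N) \<times> Pow R"
  have finA: "finite A"
    unfolding A_def using finite_N finite_R by (intro finite_cartesian_product finite_PiE) auto
  have cardA: "card A = 2 ^ (card N * k) * 2 ^ card R"
    unfolding A_def using finite_N finite_R
    by (simp add: card_cartesian_product card_PiE card_Pow power_mult)
  have sub: "exceptional \<subseteq> (\<Union>i\<in>{..l}. \<Union>w\<in>{{}, N}. enc i w ` A)"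
  proof
    fix f assume "f \<in> exceptional"
    then obtain i w where f: "f \<in> box" "i \<le> l" "\<forall>j<i. f j = S" "w \<in> {{}, N}"
      "\<forall>j. i + k \<le> j \<and> j < l \<longrightarrow> f j = w"
      unfolding exceptional_def by blast
    \<comment> \<open>The window may run past the last block, where \<open>g\<close> takes the
      default \<open>{}\<close>; the restriction places \<open>g\<close> in the extensional function
      space being counted.\<close>
    define g where "g = restrict (\<lambda>t. if i + t < l then f (i + t) else {}) {..<k}"
    have fb: "f j \<subseteq> block j" for j
      using f(1) by (simp add: box_def)
    have "g t \<subseteq> N" if "t < k" for t
      using fb[of "i + t"] that by (auto simp: g_def block_def split: if_splits)
    then have "(g, f l) \<in> A"
      using fb[of l] by (auto simp: A_def g_def block_def)
    moreover have "enc i w (g, f l) = f"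
    proof
      fix j
      have "f j = {}" if "l < j"
        using fb[of j] that by (simp add: block_def)
      then show "enc i w (g, f l) j = f j"
        using f by (auto simp: enc_def g_def)
    qed
    ultimately have "f \<in> enc i w ` A"
      by (metis imageI)
    then show "f \<in> (\<Union>i\<in>{..l}. \<Union>w\<in>{{}, N}. enc i w ` A)"
      using f(2,4) by (intro UN_I[of i] UN_I[of w]) simp_all
  qed
  have fin: "finite (\<Union>i\<in>{..l}. \<Union>w\<in>{{}, N}. enc i w ` A)"
    using finA by simp
  have "card (\<Union>i\<in>{..l}. \<Union>w\<in>{{}, N}. enc i w ` A) \<le> Suc l * (2 * card A)"
  proof -
    have "card (\<Union>w\<in>{{}, N}. enc i w ` A) \<le> 2 * card A" for i
    proof -
      have "card (\<Union>w\<in>{{}, N}. enc i w ` A) \<le> card (enc i {} ` A) + card (enc i N ` A)"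
        using card_Un_le by simp
      also have "\<dots> \<le> card A + card A"
        using finA by (intro add_mono card_image_le)
      finally show ?thesis
        by simp
    qed
    then have "(\<Sum>i\<in>{..l}. card (\<Union>w\<in>{{}, N}. enc i w ` A)) \<le> (\<Sum>i\<in>{..l}. 2 * card A)"
      by (rule sum_mono)
    then show ?thesis
      using card_UN_le[of "{..l}" "\<lambda>i. \<Union>w\<in>{{}, N}. enc i w ` A"] by simp
  qed
  with card_mono[OF fin sub] finite_subset[OF sub fin] show ?thesis
    unfolding cardA by (intro conjI) (assumption, rule order_trans)
qed

text \<open>The disjoint union of the blocks has \<open>n\<close> points, so a bijection with
  \<open>{1..n}\<close> turns \<open>box\<close> under the pointwise order into the power set under
  inclusion.\<close>

lemma sat_star_bound:
  assumes n: "n = l * card N + card R"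
  shows "sat_star n (copies m (chain_poset k)) \<le> Suc l * (2 * (2 ^ (card N * k) * 2 ^ card R))"
proof -
  define \<Omega> where "\<Omega> = Sigma {..l} block"
  have fin_block: "finite (block i)" for i
    using finite_N finite_R by (simp add: block_def)
  then have "finite \<Omega>"
    by (simp add: \<Omega>_def)
  have "card \<Omega> = (\<Sum>i\<le>l. card (block i))"
    unfolding \<Omega>_def using fin_block by (intro card_SigmaI) auto
  also have "\<dots> = (\<Sum>i<l. card (block i)) + card (block l)"
    by (simp add: lessThan_Suc_atMost[symmetric])
  also have "\<dots> = n"
    using n by (simp add: block_def)
  finally have "card \<Omega> = card {1..n}"
    by simp
  then obtain h where h: "bij_betw h \<Omega> {1..n}"
    using finite_same_card_bij[OF \<open>finite \<Omega>\<close>] by blast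
  define \<phi> where "\<phi> f = h ` Sigma {..l} f" for f
  have sub: "Sigma {..l} f \<subseteq> \<Omega>" if "f \<in> box" for f
    using that by (auto simp: \<Omega>_def box_def)
  have emb: "\<phi> f \<subseteq> \<phi> g \<longleftrightarrow> f \<le> g" if "f \<in> box" "g \<in> box" for f g
  proof -
    have "\<phi> f \<subseteq> \<phi> g \<longleftrightarrow> Sigma {..l} f \<subseteq> Sigma {..l} g"
    proof
      assume *: "\<phi> f \<subseteq> \<phi> g"
      show "Sigma {..l} f \<subseteq> Sigma {..l} g"
      proof
        fix x assume "x \<in> Sigma {..l} f"
        then have "h x \<in> h ` Sigma {..l} g" "x \<in> \<Omega>"
          using * sub[OF that(1)] unfolding \<phi>_def by blast+
        then show "x \<in> Sigma {..l} g"
          using inj_on_image_mem_iff[OF _ \<open>x \<in> \<Omega>\<close> sub[OF that(2)], of h] h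
          by (simp add: bij_betw_def)
      qed
    qed (auto simp: \<phi>_def)
    also have "\<dots> \<longleftrightarrow> (\<forall>i\<le>l. f i \<subseteq> g i)"
      by auto
    also have "\<dots> \<longleftrightarrow> f \<le> g"
    proof -
      have "f i = {}" if "l < i" for i
      proof -
        have "f i \<subseteq> block i"
          using \<open>f \<in> box\<close> by (simp add: box_def)
        then show ?thesis
          using that by (simp add: block_def)
      qed
      then show ?thesis
        unfolding le_fun_def by (metis empty_subsetI not_le)
    qed
    finally show ?thesis .
  qed
  have surj: "\<exists>f\<in>box. \<phi> f = G" if G: "G \<in> Pow {1..n}" for G
  proof -
    have "G \<subseteq> h ` \<Omega>"
      using G h by (simp add: bij_betw_def)
    then obtain V where V: "V \<subseteq> \<Omega>" "G = h ` V"
      by (elim subset_imageE)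
    define f where "f i = {x. (i, x) \<in> V}" for i
    have "Sigma {..l} f = V"
      using V by (auto simp: f_def \<Omega>_def)
    moreover have "f \<in> box"
      using V by (auto simp: f_def \<Omega>_def box_def)
    ultimately show ?thesis
      using V by (auto simp: \<phi>_def)
  qed
  have box_image: "has_chains m k (\<phi> ` F) \<longleftrightarrow> has_chains m k F" if "F \<subseteq> box" for F
    using emb that by (intro has_chains_image_iff) auto
  have "sat_star n (copies m (chain_poset k)) \<le> card (\<phi> ` exceptional)"
  proof (rule sat_star_le_card_candidates[of "\<phi> ` family"])
    show "\<phi> ` family \<subseteq> Pow {1..n}"
      using sub family_subset_box h by (fastforce simp: \<phi>_def bij_betw_def)
    show "\<not> has_chains m k (\<phi> ` family)"
      using box_image family_subset_box family_has_no_chains by blast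
    show "finite (\<phi> ` exceptional)"
      using card_exceptional by blast
    fix G assume "G \<in> Pow {1..n}" "G \<notin> \<phi> ` exceptional"
    then obtain f where f: "f \<in> box" "\<phi> f = G" "f \<notin> exceptional"
      using surj by blast
    then have "has_chains m k (\<phi> ` insert f family)"
      using box_image[of "insert f family"] insert_has_chains family_subset_box by blast
    then show "has_chains m k (insert G (\<phi> ` family))"
      using f by simp
  qed
  also have "\<dots> \<le> card exceptional"
    using card_exceptional card_image_le by blast
  also have "\<dots> \<le> Suc l * (2 * (2 ^ (card N * k) * 2 ^ card R))"
    using card_exceptional by blast
  finally show ?thesis .
qed

end

theorem theorem1p4:
  fixes m k :: nat
  assumes "m \<ge> 1" and "k \<ge> 1"
  shows "\<exists>C::real. \<forall>n::nat. n \<ge> 1 \<longrightarrow>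
           real (sat_star n (copies m (chain_poset k))) \<le> C * real n"
proof -
  interpret chain_gadget k "ground k" "letters k" "gadget_low k" "gadget_high k"
    "\<lambda>X. card {s. Inl s \<in> X}" "level k"
    using assms(2) by (rule chain_gadget_orderings)
  define c where "c = card (ground k)"
  have "c > 0"
    using finite_N S_subset by (auto simp: c_def card_gt_0_iff)
  \<comment> \<open>The first summand serves \<open>n \<ge> m\<close>: one factor 2 comes from
    \<open>Suc l \<le> 2 * n\<close>, the other from the two values of \<open>w\<close>. The second
    serves \<open>n < m\<close>.\<close>
  define C where "C = 4 * (2 ^ (c * k) * 2 ^ (m + c)) + (2::nat) ^ m"
  have "sat_star n (copies m (chain_poset k)) \<le> C * n" if "n \<ge> 1" for n
  proof (cases "n < m")
    case True
    have "sat_star n (copies m (chain_poset k)) \<le> 2 ^ n"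
      using sat_star_le_power assms by blast
    also have "(2::nat) ^ n \<le> 2 ^ m"
      using True by (intro power_increasing) auto
    also have "\<dots> \<le> C * 1"
      by (simp add: C_def)
    also have "\<dots> \<le> C * n"
      using that by (intro mult_left_mono) auto
    finally show ?thesis .
  next
    case False
    \<comment> \<open>The final block receives \<open>m\<close> reserved points and the remainder
      modulo \<open>c\<close>. Thus \<open>m \<le> \<rho> < m + c\<close>: it properly contains
      \<open>m - 1\<close> points for the rails, and its size stays bounded.\<close>
    define l where "l = (n - m) div c"
    define \<rho> where "\<rho> = m + (n - m) mod c"
    have n: "n = l * c + \<rho>"
      using False by (simp add: l_def \<rho>_def)
    \<comment> \<open>Here \<open>Inl\<close> merely supplies distinct points of the required
      type.\<close>
    define R :: "(nat + nat list) set" where "R = Inl ` {..<\<rho>}"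
    define P :: "(nat + nat list) set" where "P = Inl ` {..<m - 1}"
    have cards: "card R = \<rho>" "card P = m - 1"
      by (simp_all add: R_def P_def card_image)
    have "P \<subseteq> R"
      unfolding P_def R_def by (intro image_mono) (auto simp: \<rho>_def)
    moreover have "P \<noteq> R"
      using cards assms(1) by (auto simp: \<rho>_def)
    ultimately interpret gadget_stack k "ground k" "letters k" "gadget_low k" "gadget_high k"
      "\<lambda>X. card {s. Inl s \<in> X}" "level k" l m R P
      using assms(1) cards by unfold_locales (auto simp: R_def)
    have "sat_star n (copies m (chain_poset k)) \<le> Suc l * (2 * (2 ^ (c * k) * 2 ^ \<rho>))"
      using sat_star_bound[of n] n cards by (simp add: c_def)
    also have "\<dots> \<le> (2 * n) * (2 * (2 ^ (c * k) * 2 ^ (m + c)))"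
    proof (intro mult_mono power_increasing order_refl)
      have "l \<le> n"
        unfolding l_def by (meson diff_le_self div_le_dividend order_trans)
      then show "Suc l \<le> 2 * n"
        using that by simp
      show "\<rho> \<le> m + c"
        using \<open>c > 0\<close> by (simp add: \<rho>_def less_imp_le)
    qed auto
    also have "\<dots> \<le> C * n"
      by (simp add: C_def algebra_simps)
    finally show ?thesis .
  qed
  then have "\<forall>n\<ge>1. real (sat_star n (copies m (chain_poset k))) \<le> real C * real n"
    by (metis of_nat_le_iff of_nat_mult)
  then show ?thesis
    by blast
qed

end
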